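(* Let $q,c\in\mathbb{C}$ be constants with $q\neq 0$, and consider the system $$\begin{cases} w_1'(z)^{2}+w_2(qz+c)^{2}=1,\\ w_2'(z)^{2}+w_1(qz+c)^{2}=1.\end{cases}$$ (1) If $q\neq\pm 1$, then the system does not possess any transcendental entire solutions of finite order. (2) If $q=1$, then the system has the finite-order transcendental entire solutions $(w_1(z),w_2(z))$ with $$(w_1(z),w_2(z))=(\sin(z+B_1),\ \sin(z+B_2)),$$ where $B_1,B_2$ are two complex constants, and either $c=k\pi$ and $B_1-B_2=l\pi$, or $c=\frac{\pi}{2}+k\pi$ and $B_1-B_2=\frac{\pi}{2}+l\pi$ ($l,k\in\mathbb{Z}$). (3) If $q=-1$, then the system has the finite-order transcendental entire solutions $(w_1(z),w_2(z))$ with $$(w_1(z),w_2(z))=(\sin(z+B_1),\ \sin(z+B_2)),$$ where $B_1,B_2$ are two complex constants and $B_1+B_2+c=k\pi$ ($k\in\mathbb{Z}$).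
   Context: The order of a meromorphic (in particular entire) function $w$ is $\rho(w)=\limsup_{r\to\infty}\frac{\log^{+}T(r,w)}{\log r}$, where $T(r,w)$ is the Nevanlinna characteristic function. The order of a solution pair is $\rho(w_1,w_2)=\max\{\rho(w_1),\rho(w_2)\}$, and the pair is of finite order if this is finite. A transcendental entire solution is a pair $(w_1,w_2)$ of transcendental (i.e. non-polynomial) entire functions satisfying both equations for all $z\in\mathbb{C}$. *)

theory Defs
  imports "HOL-Complex_Analysis.Complex_Analysis"
begin

text \<open>\<open>log\<^sup>+ x = max (log x) 0\<close> for \<open>x > 0\<close> and \<open>log\<^sup>+ 0 = 0\<close>; the form below does not
  depend on the value of \<^const>\<open>ln\<close> at \<open>0\<close>.\<close>

definition log_plus :: "real \<Rightarrow> real"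
  where "log_plus x = ln (max 1 x)"

definition proximity_fun :: "real \<Rightarrow> (complex \<Rightarrow> complex) \<Rightarrow> real"
  where "proximity_fun r f =
    1 / (2 * pi) * integral {0..2 * pi} (\<lambda>\<theta>. log_plus (norm (f (of_real r * cis \<theta>))))"

text \<open>Poles in the closed disc of radius \<open>t\<close>, with multiplicity. At a pole, \<^const>\<open>zorder\<close> is
  negative and its absolute value is the order of the pole.\<close>

definition pole_count :: "real \<Rightarrow> (complex \<Rightarrow> complex) \<Rightarrow> nat"
  where "pole_count t f = (\<Sum>z | norm z \<le> t \<and> is_pole f z. nat (- zorder f z))"

definition pole_counting_fun :: "real \<Rightarrow> (complex \<Rightarrow> complex) \<Rightarrow> real"
  where "pole_counting_fun r f =
    integral {0..r} (\<lambda>t. (real (pole_count t f) - real (pole_count 0 f)) / t)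
      + real (pole_count 0 f) * ln r"

definition nevanlinna_T :: "real \<Rightarrow> (complex \<Rightarrow> complex) \<Rightarrow> real"
  where "nevanlinna_T r f = proximity_fun r f + pole_counting_fun r f"

definition growth_order :: "(complex \<Rightarrow> complex) \<Rightarrow> ereal"
  where "growth_order f = Limsup at_top (\<lambda>r. ereal (log_plus (nevanlinna_T r f) / ln r))"

definition pair_order :: "(complex \<Rightarrow> complex) \<Rightarrow> (complex \<Rightarrow> complex) \<Rightarrow> ereal"
  where "pair_order f g = max (growth_order f) (growth_order g)"

definition transcendental_entire :: "(complex \<Rightarrow> complex) \<Rightarrow> bool"
  where "transcendental_entire f \<longleftrightarrow> f holomorphic_on UNIV \<and> \<not> (\<exists>p. f = poly p)"

definition solves_system ::
    "complex \<Rightarrow> complex \<Rightarrow> (complex \<Rightarrow> complex) \<Rightarrow> (complex \<Rightarrow> complex) \<Rightarrow> bool"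
  where "solves_system q c w1 w2 \<longleftrightarrow>
    (\<forall>z. (deriv w1 z)\<^sup>2 + (w2 (q * z + c))\<^sup>2 = 1 \<and>
         (deriv w2 z)\<^sup>2 + (w1 (q * z + c))\<^sup>2 = 1)"

definition transcendental_entire_solution ::
    "complex \<Rightarrow> complex \<Rightarrow> (complex \<Rightarrow> complex) \<Rightarrow> (complex \<Rightarrow> complex) \<Rightarrow> bool"
  where "transcendental_entire_solution q c w1 w2 \<longleftrightarrow>
    transcendental_entire w1 \<and> transcendental_entire w2 \<and> solves_system q c w1 w2"

end

theory Submission imports Defs begin

text \<open>Put \<open>E(z) = w\<^sub>1'((z - c) / q) + \<i> w\<^sub>2(z)\<close>. By the first equation \<open>E\<close> has no zeros and
  \<open>1 / E = E - 2 \<i> w\<^sub>2\<close>, so \<open>log\<^sup>+ \<bar>E\<bar> \<le> log\<^sup>+ \<bar>w\<^sub>2\<bar> + log 3\<close> pointwise. Hence \<open>E = exp P\<close> where the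
  circle means of the positive part of \<open>Re P\<close> grow at most polynomially, which makes \<open>P\<close> a
  polynomial; no growth estimate for derivatives or shifts is needed. Thus
  \<open>w\<^sub>2 = -\<i> sinh P\<close> and \<open>w\<^sub>1'(z) = cosh (P (q z + c))\<close>, and symmetrically \<open>w\<^sub>1 = -\<i> sinh R\<close>. Differentiating the latter gives
  \<open>cosh (P (q z + c)) = -\<i> R' cosh R\<close>, and the linear independence of exponentials of
  polynomials over the polynomials forces \<open>R' = \<plusminus>\<i>\<close>, likewise \<open>P' = \<plusminus>\<i>\<close>, and \<open>q P' = \<plusminus>R'\<close>.\<close>

section \<open>Proximity function and finite order for entire functions\<close>

lemma nevanlinna_T_entire:
  assumes "f holomorphic_on UNIV"
  shows "nevanlinna_T r f = proximity_fun r f"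
proof -
  have "\<not> is_pole f z" for z
    using assms by (metis not_is_pole_holomorphic open_UNIV UNIV_I)
  then show ?thesis
    by (simp add: nevanlinna_T_def pole_counting_fun_def pole_count_def)
qed

lemma continuous_on_log_plus:
  assumes "continuous_on S f"
  shows "continuous_on S (\<lambda>x. log_plus (f x))"
  unfolding log_plus_def using assms by (intro continuous_intros) auto

lemma continuous_on_circle:
  fixes f :: "complex \<Rightarrow> complex"
  assumes "f holomorphic_on UNIV"
  shows "continuous_on S (\<lambda>t. f (of_real r * cis t))"
proof (rule continuous_on_compose2[of UNIV f])
  show "continuous_on UNIV f"
    using assms by (rule holomorphic_on_imp_continuous_on)
qed (auto intro!: continuous_intros)

lemma log_plus_circle_integrable:
  fixes f :: "complex \<Rightarrow> complex"
  assumes "f holomorphic_on UNIV"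
  shows "(\<lambda>t. log_plus (norm (f (of_real r * cis t)))) integrable_on {a..b}"
  by (intro integrable_continuous_real continuous_on_log_plus continuous_on_norm
      continuous_on_circle assms)

text \<open>Turns finite order into a usable growth bound: once
  \<open>log_plus T / ln r < n\<close>, exponentiating gives \<open>max 1 T < r ^ n\<close>, and
  \<open>T\<close> is the proximity function since there are no poles.\<close>

lemma proximity_fun_finite_order:
  assumes "f holomorphic_on UNIV" and "growth_order f < \<infinity>"
  shows "\<exists>n. \<forall>\<^sub>F r in at_top. proximity_fun r f \<le> r ^ n"
proof -
  obtain n :: nat where n: "growth_order f < ereal (real n)"
    using assms(2) less_PInf_Ex_of_nat[of "growth_order f"] by auto
  have "\<forall>\<^sub>F r in at_top. ereal (log_plus (nevanlinna_T r f) / ln r) < ereal (real n)"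
    using n unfolding growth_order_def by (rule Limsup_lessD)
  moreover have "\<forall>\<^sub>F r :: real in at_top. r > 1"
    by (rule eventually_gt_at_top)
  ultimately have "\<forall>\<^sub>F r in at_top. proximity_fun r f \<le> r ^ n"
  proof eventually_elim
    case (elim r)
    have "ln (max 1 (proximity_fun r f)) < real n * ln r"
      using elim assms(1) by (simp add: nevanlinna_T_entire log_plus_def field_simps)
    also have "\<dots> = ln (r ^ n)"
      using elim by (simp add: ln_realpow)
    finally have "max 1 (proximity_fun r f) < r ^ n"
      using elim by (subst (asm) ln_less_cancel_iff) auto
    then show ?case by simp
  qed
  then show ?thesis ..
qed

section \<open>Taylor coefficients of an entire \<open>f\<close> bounded by the proximity function
  of \<open>exp f\<close>\<close>

text \<open>Cauchy's formula for higher derivatives, read as the statement that Fourier coefficients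
  on a circle are scaled Taylor coefficients. The case \<open>n = 0\<close> is the mean value
  property.\<close>

lemma taylor_coeff_has_integral_circle:
  fixes f :: "complex \<Rightarrow> complex"
  assumes "f holomorphic_on UNIV" and "r > 0"
  shows "((\<lambda>t. f (of_real r * cis t) * cis (- (real n * t)))
           has_integral (2 * pi * ((deriv ^^ n) f 0 / fact n) * of_real r ^ n)) {0..2 * pi}"
proof -
  have "((\<lambda>u. f u / (u - 0) ^ Suc n) has_contour_integral
          (2 * pi * \<i> / fact n * (deriv ^^ n) f 0)) (circlepath 0 r)"
    using assms by (intro Cauchy_has_contour_integral_higher_derivative_circlepath)
      (auto intro: holomorphic_on_imp_continuous_on holomorphic_on_subset)
  then have "((\<lambda>t. f (of_real r * cis t) / (of_real r * cis t) ^ Suc n * of_real r * \<i> * cis t)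
          has_integral (2 * pi * \<i> / fact n * (deriv ^^ n) f 0)) {0..2 * pi}"
    unfolding circlepath_def by (subst (asm) has_contour_integral_part_circlepath_iff) auto
  \<comment> \<open>On the circle \<open>dz = i z dt\<close>, so the integrand is
    \<open>i / r ^ n\<close> times the desired one; this factor removes that constant.\<close>
  from has_integral_mult_right[OF this, of "of_real r ^ n / \<i>"]
  show ?thesis
  proof (rule has_integral_eq_rhs[OF has_integral_eq, rotated])
    fix t
    have "cis t ^ n * cis (- (real n * t)) = 1"
      by (simp add: Complex.DeMoivre cis_mult)
    then have "cis (- (real n * t)) = 1 / cis t ^ n"
      by (simp add: field_simps)
    then show "of_real r ^ n / \<i> * (f (of_real r * cis t) / (of_real r * cis t) ^ Suc n
        * of_real r * \<i> * cis t) = f (of_real r * cis t) * cis (- (real n * t))"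
      using assms(2) by (simp add: field_simps power_mult_distrib)
  qed (simp add: field_simps)
qed

text \<open>On the circle, \<open>Re f = (f + cnj f) / 2\<close>, and \<open>cnj f\<close> contributes nothing to the
  Fourier coefficients of positive index.\<close>

lemma taylor_coeff_bound_Re:
  fixes f :: "complex \<Rightarrow> complex"
  assumes hol: "f holomorphic_on UNIV" and r: "r > 0" and n: "n > 0"
  shows "norm ((deriv ^^ n) f 0 / fact n) * r ^ n
           \<le> 4 * proximity_fun r (\<lambda>z. exp (f z)) - 2 * Re (f 0)"
proof -
  define a where "a = (deriv ^^ n) f 0 / fact n"
  define u where "u = (\<lambda>t. Re (f (of_real r * cis t)))"
  have A: "((\<lambda>t. f (of_real r * cis t) * cis (- (real n * t)))
           has_integral (2 * pi * a * of_real r ^ n)) {0..2 * pi}"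
    using taylor_coeff_has_integral_circle[OF hol r] unfolding a_def .
  have "(\<lambda>z. f z * z ^ n) holomorphic_on UNIV"
    using hol by (intro holomorphic_intros)
  \<comment> \<open>Mean value property of \<open>f z * z ^ n\<close>, which vanishes at the origin
    because \<open>n > 0\<close>. Conjugating the result gives the coefficient of
    \<open>cnj f\<close>.\<close>
  from taylor_coeff_has_integral_circle[OF this r, of 0]
  have "((\<lambda>t. f (of_real r * cis t) * (of_real r * cis t) ^ n) has_integral 0) {0..2 * pi}"
    using n by (simp add: power_0_left)
  from has_integral_mult_right[OF this, of "1 / of_real r ^ n"]
  have "((\<lambda>t. f (of_real r * cis t) * cis (real n * t)) has_integral 0) {0..2 * pi}"
    using r by (simp add: power_mult_distrib Complex.DeMoivre)
  then have "((\<lambda>t. cnj (f (of_real r * cis t)) * cis (- (real n * t))) has_integral 0) {0..2 * pi}"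
    using has_integral_cnj[of "\<lambda>t. f (of_real r * cis t) * cis (real n * t)" 0]
    by (simp add: o_def cis_cnj)
  from has_integral_add[OF A this]
  have B: "((\<lambda>t. of_real (2 * u t) * cis (- (real n * t)))
      has_integral (2 * pi * a * of_real r ^ n)) {0..2 * pi}"
    by (simp add: u_def complex_add_cnj distrib_right[symmetric])
  have "((\<lambda>t. f (of_real r * cis t)) has_integral (2 * pi * f 0)) {0..2 * pi}"
    using taylor_coeff_has_integral_circle[OF hol r, of 0] by simp
  from has_integral_Re[OF this]
  have U: "(u has_integral (2 * pi * Re (f 0))) {0..2 * pi}"
    by (simp add: u_def)
  have "log_plus (norm (exp (f (of_real r * cis t)))) = max 0 (u t)" for t
    unfolding log_plus_def u_def norm_exp_eq_Re
    by (smt (verit, best) exp_ln_iff ln_exp ln_one one_le_exp_iff exp_less_one_iff)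
  moreover have "(\<lambda>z. exp (f z)) holomorphic_on UNIV"
    using hol by (intro holomorphic_intros)
  ultimately have P: "((\<lambda>t. max 0 (u t)) has_integral
      (2 * pi * proximity_fun r (\<lambda>z. exp (f z)))) {0..2 * pi}"
    using log_plus_circle_integrable[of "\<lambda>z. exp (f z)" r 0 "2 * pi"]
    by (simp add: proximity_fun_def has_integral_integral)
  \<comment> \<open>Pointwise \<open>|2 u| = 2 (2 max 0 u - u)\<close>, and the integrals of both
    terms are known from \<open>P\<close> and \<open>U\<close>; this is the source of the constants
    4 and 2.\<close>
  have "norm (2 * pi * a * of_real r ^ n)
      \<le> 2 * (2 * (2 * pi * proximity_fun r (\<lambda>z. exp (f z))) - 2 * pi * Re (f 0))"
    using has_integral_norm_bound_integral_component[OF B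
        has_integral_mult_right[OF has_integral_diff[OF has_integral_mult_right[OF P, of 2] U], of 2],
        of 1]
    by (simp add: norm_mult max_def)
  then have "2 * pi * (norm a * r ^ n)
      \<le> 2 * pi * (4 * proximity_fun r (\<lambda>z. exp (f z)) - 2 * Re (f 0))"
    using r by (simp add: norm_mult norm_power algebra_simps)
  then show ?thesis
    unfolding a_def by simp
qed

text \<open>Liouville's argument with a circle mean in place of the maximum modulus: for
  \<open>n > N\<close> the coefficient bound is of size \<open>r ^ N / r ^ n\<close> up to lower
  terms, so letting \<open>r\<close> grow kills the coefficient.\<close>

lemma entire_eq_poly_if_proximity_exp_le:
  fixes f :: "complex \<Rightarrow> complex"
  assumes hol: "f holomorphic_on UNIV"
    and bound: "\<forall>\<^sub>F r in at_top. proximity_fun r (\<lambda>z. exp (f z)) \<le> B + r ^ N"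
  shows "\<exists>p. f = poly p"
proof -
  define a where "a = (\<lambda>n. (deriv ^^ n) f 0 / fact n)"
  have zero: "a n = 0" if n: "n > N" for n
  proof -
    have "\<forall>\<^sub>F r in at_top. norm (a n) \<le> (4 * (B + r ^ N) - 2 * Re (f 0)) / r ^ n"
      using bound eventually_gt_at_top[of 0]
    proof eventually_elim
      case (elim r)
      then show ?case
        using taylor_coeff_bound_Re[OF hol, of r n] n by (simp add: a_def field_simps)
    qed
    moreover have "((\<lambda>r :: real. (4 * (B + r ^ N) - 2 * Re (f 0)) / r ^ n) \<longlongrightarrow> 0) at_top"
    proof -
      obtain k where k: "n = Suc (N + k)"
        using n less_iff_Suc_add by blast
      have "((\<lambda>r :: real. (4 * B - 2 * Re (f 0)) * (inverse r) ^ n + 4 * (inverse r) ^ Suc k)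
          \<longlongrightarrow> (4 * B - 2 * Re (f 0)) * 0 ^ n + 4 * 0 ^ Suc k) at_top"
        by (intro tendsto_intros tendsto_inverse_0_at_top filterlim_ident)
      then have "((\<lambda>r :: real. (4 * B - 2 * Re (f 0)) * (inverse r) ^ n + 4 * (inverse r) ^ Suc k)
          \<longlongrightarrow> 0) at_top"
        using n by (simp add: power_0_left)
      then show ?thesis
      proof (rule Lim_transform_eventually)
        show "\<forall>\<^sub>F r :: real in at_top. (4 * B - 2 * Re (f 0)) * inverse r ^ n + 4 * inverse r ^ Suc k
            = (4 * (B + r ^ N) - 2 * Re (f 0)) / r ^ n"
          using eventually_gt_at_top[of 0]
          by eventually_elim (simp add: k field_simps power_add)
      qed
    qed
    ultimately have "norm (a n) \<le> 0"
      by (intro tendsto_lowerbound[where F = at_top]) auto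
    then show ?thesis by simp
  qed
  have "f z = poly (\<Sum>n\<le>N. monom (a n) n) z" for z
  proof -
    have "(\<lambda>n. a n * (z - 0) ^ n) sums f z"
      unfolding a_def
      by (rule holomorphic_power_series[where r = "norm z + 1"])
        (auto intro: holomorphic_on_subset[OF hol])
    moreover have "(\<lambda>n. a n * (z - 0) ^ n) sums (\<Sum>n\<le>N. a n * (z - 0) ^ n)"
      by (rule sums_finite) (auto simp: zero)
    ultimately show ?thesis
      by (simp add: sums_unique2 poly_sum poly_monom)
  qed
  then show ?thesis by blast
qed

section \<open>Linear independence of exponentials of polynomials\<close>

text \<open>Multiplying by \<open>exp (- Q j)\<close> and differentiating \<open>Suc (degree (R j))\<close> times kills the
  \<open>j\<close>-th term, while the other coefficients stay nonzero because their degrees do not drop.\<close>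

lemma exp_poly_independent:
  fixes Q R :: "'a \<Rightarrow> complex poly"
  assumes "finite S"
    and "\<And>i j. i \<in> S \<Longrightarrow> j \<in> S \<Longrightarrow> i \<noteq> j \<Longrightarrow> degree (Q i - Q j) > 0"
    and "\<And>z. (\<Sum>i\<in>S. poly (R i) z * exp (poly (Q i) z)) = 0"
  shows "\<forall>i\<in>S. R i = 0"
  using assms
proof (induction S arbitrary: R rule: finite_induct)
  case empty
  then show ?case by simp
next
  case (insert j S)
  \<comment> \<open>\<open>D i p\<close> is the polynomial factor in the derivative of
    \<open>p * exp (Q i - Q j)\<close>; for \<open>i = j\<close> it is plain
    differentiation.\<close>
  define D where "D = (\<lambda>i (p :: complex poly). pderiv p + p * pderiv (Q i - Q j))"
  have D_nz: "D i p \<noteq> 0" if "i \<in> S" "p \<noteq> 0" for i p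
  proof -
    have "degree (Q i - Q j) > 0"
      using insert.prems(1) insert.hyps that by blast
    then have nz: "pderiv (Q i - Q j) \<noteq> 0"
      by (simp add: pderiv_eq_0_iff)
    show ?thesis
    proof (cases "degree p = 0")
      case True
      then show ?thesis
        using nz that by (simp add: D_def pderiv_eq_0_iff[THEN iffD2])
    next
      case False
      have "degree (pderiv p) < degree (p * pderiv (Q i - Q j))"
        using nz that False by (simp add: degree_pderiv degree_mult_eq)
      then show ?thesis
        unfolding D_def by (metis degree_add_eq_right degree_0 not_less0)
    qed
  qed
  have Dk: "(\<Sum>i\<in>insert j S. poly ((D i ^^ k) (R i)) z * exp (poly (Q i - Q j) z)) = 0" for k z
  proof (induction k arbitrary: z)
    case 0
    have "(\<Sum>i\<in>insert j S. poly (R i) z * exp (poly (Q i - Q j) z))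
        = exp (- poly (Q j) z) * (\<Sum>i\<in>insert j S. poly (R i) z * exp (poly (Q i) z))"
      by (simp only: sum_distrib_left poly_diff exp_diff exp_minus)
        (simp add: field_simps)
    then show ?case
      using insert.prems(2) by simp
  next
    case (Suc k)
    let ?F = "\<lambda>z. \<Sum>i\<in>insert j S. poly ((D i ^^ k) (R i)) z * exp (poly (Q i - Q j) z)"
    have "(?F has_field_derivative
        (\<Sum>i\<in>insert j S. poly ((D i ^^ Suc k) (R i)) z * exp (poly (Q i - Q j) z))) (at z)"
      unfolding D_def
      by (rule DERIV_sum) (auto intro!: derivative_eq_intros simp: pderiv_diff algebra_simps)
    moreover have "(?F has_field_derivative 0) (at z)"
      using Suc by simp
    ultimately show ?case
      by (rule DERIV_unique)
  qed
  define m where "m = Suc (degree (R j))"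
  have "D j = pderiv"
    by (simp add: D_def fun_eq_iff)
  then have "(D j ^^ m) (R j) = 0"
    by (simp add: m_def poly_eq_iff coeff_higher_pderiv coeff_eq_0 del: funpow.simps)
  then have "(\<Sum>i\<in>S. poly ((D i ^^ m) (R i)) z * exp (poly (Q i - Q j) z)) = 0" for z
    using Dk[of m z] insert.hyps by simp
  then have "(\<Sum>i\<in>S. poly ((D i ^^ m) (R i)) z * exp (poly (Q i) z)) = 0" for z
  proof -
    have "(\<Sum>i\<in>S. poly ((D i ^^ m) (R i)) z * exp (poly (Q i) z))
      = exp (poly (Q j) z) * (\<Sum>i\<in>S. poly ((D i ^^ m) (R i)) z * exp (poly (Q i - Q j) z))"
      by (simp only: sum_distrib_left poly_diff exp_diff)
        (simp add: field_simps)
    then show ?thesis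
      using \<open>\<And>z. (\<Sum>i\<in>S. poly ((D i ^^ m) (R i)) z * exp (poly (Q i - Q j) z)) = 0\<close> by simp
  qed
  then have "\<forall>i\<in>S. (D i ^^ m) (R i) = 0"
    by (intro insert.IH insert.prems(1)) auto
  moreover have "(D i ^^ k) p \<noteq> 0" if "i \<in> S" "p \<noteq> 0" for i k p
    using that by (induction k) (auto simp: D_nz)
  ultimately have S: "\<forall>i\<in>S. R i = 0"
    by blast
  have "poly (R j) z = 0" for z
    using insert.prems(2)[of z] insert.hyps S by simp
  then have "R j = 0"
    by (simp add: poly_all_0_iff_0[symmetric])
  with S show ?case by simp
qed

text \<open>Independence is used twice. If neither \<open>a - b\<close> nor \<open>a + b\<close>
  were constant, the exponentials of \<open>a\<close>, \<open>-a\<close>, \<open>b\<close>,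
  \<open>-b\<close> would be independent, although \<open>exp a\<close> has coefficient 1. Hence
  \<open>a = s b + k\<close> with \<open>s = 1\<close> or \<open>s = -1\<close>, and comparing the
  coefficients of \<open>exp b\<close> and \<open>exp (- b)\<close> gives
  \<open>A = exp (s k) = exp (- s k)\<close>, a constant of square 1.\<close>

lemma cosh_poly_eq_cases:
  fixes a b A :: "complex poly"
  assumes a: "degree a > 0" and b: "degree b > 0"
    and eq: "\<And>z. cosh (poly a z) = poly A z * cosh (poly b z)"
  shows "A = 1 \<or> A = -1" and "pderiv a = pderiv b \<or> pderiv a = - pderiv b"
proof -
  have eq': "exp (poly a z) + exp (- poly a z) - poly A z * exp (poly b z)
      - poly A z * exp (- poly b z) = 0" for z
    using eq[of z] unfolding cosh_field_def by algebra
  have nz: "a \<noteq> 0" "b \<noteq> 0"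
    using a b by auto
  have key: "\<exists>s k. s \<in> {1, -1} \<and> a = smult s b + [:k:]"
  proof (rule ccontr)
    assume no: "\<not> ?thesis"
    have no1: "a - b \<noteq> [:k:]" for k
    proof
      assume "a - b = [:k:]"
      then have "a = smult 1 b + [:k:]" by (simp add: algebra_simps)
      with no show False by blast
    qed
    have no2: "a + b \<noteq> [:k:]" for k
    proof
      assume "a + b = [:k:]"
      then have "a = smult (-1) b + [:k:]" by (simp add: algebra_simps flip: \<open>a + b = [:k:]\<close>)
      with no show False by blast
    qed
    define Q where "Q = (!) [a, - a, b, - b]"
    define R where "R = (!) [1, 1, - A, - A]"
    have d: "degree (a - b) > 0" "degree (a + b) > 0"
      using no1 no2 by (metis degree_eq_zeroE gr0I)+
    \<comment> \<open>Up to sign, the differences of distinct exponents are only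
      \<open>a - b\<close>, \<open>a + b\<close>, \<open>2 a\<close> and \<open>2 b\<close>.\<close>
    have "b - a = - (a - b)" "- a - b = - (a + b)" "b + a = a + b" "- b - a = - (a + b)"
        "- a + b = - (a - b)" "- b + a = a - b"
      by simp_all
    then have d2: "degree (b - a) > 0" "degree (- a - b) > 0" "degree (b + a) > 0" "degree (- b - a) > 0"
        "degree (- a + b) > 0" "degree (- b + a) > 0"
      using d by (simp_all only: degree_minus)
    have d3: "degree (a + a) > 0" "degree (b + b) > 0" "degree (- a - a) > 0" "degree (- b - b) > 0"
      using a b nz by (simp_all add: degree_mult_eq)
    note d = d d2 d3
    have "\<forall>i\<in>{0, 1, 2, 3 :: nat}. R i = 0"
    proof (intro exp_poly_independent[where Q = Q])
      fix z
      show "(\<Sum>i\<in>{0, 1, 2, 3}. poly (R i) z * exp (poly (Q i) z)) = 0"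
        using eq'[of z] by (simp add: Q_def R_def algebra_simps)
    next
      fix i j :: nat
      assume "i \<in> {0, 1, 2, 3}" "j \<in> {0, 1, 2, 3}" "i \<noteq> j"
      with d show "degree (Q i - Q j) > 0"
        unfolding Q_def
        by (elim insertE emptyE) simp_all
    qed simp
    then have "R 0 = 0" by simp
    then show False by (simp add: R_def)
  qed
  then obtain s k where s: "s = 1 \<or> s = -1" and ak: "a = smult s b + [:k:]"
    by blast
  show "pderiv a = pderiv b \<or> pderiv a = - pderiv b"
    using s by (auto simp: ak pderiv_add pderiv_smult pderiv_pCons)
  define e where "e = exp (s * k)"
  define f where "f = exp (- (s * k))"
  have ef: "e * f = 1"
    by (simp add: e_def f_def exp_minus)
  \<comment> \<open>Evenness of \<open>cosh\<close> moves the sign \<open>s\<close> from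
    \<open>b\<close> to the constant \<open>k\<close>.\<close>
  have "cosh (poly a z) = cosh (poly b z + s * k)" for z
    using s cosh_minus[of "poly b z - k"] by (auto simp: ak)
  then have "cosh (poly b z + s * k) = poly A z * cosh (poly b z)" for z
    using eq[of z] by simp
  moreover have "exp (poly b z + s * k) = exp (poly b z) * e"
    and "exp (- (poly b z + s * k)) = exp (- poly b z) * f" for z
    by (simp_all add: e_def f_def exp_add[symmetric])
  ultimately have half: "(exp (poly b z) * e + exp (- poly b z) * f) / 2
      = poly A z * ((exp (poly b z) + exp (- poly b z)) / 2)" for z
    unfolding cosh_field_def by simp
  have eq2: "(e - poly A z) * exp (poly b z) + (f - poly A z) * exp (- poly b z) = 0" for z
    using half[of z] by algebra
  define R where "R = (!) [[:e:] - A, [:f:] - A]"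
  define Q where "Q = (!) [b, - b]"
  have "degree (b + b) > 0" "degree (- b - b) > 0"
    using b nz by (simp_all add: degree_mult_eq)
  then have "\<forall>i\<in>{0, 1 :: nat}. R i = 0"
    using eq2 by (intro exp_poly_independent[where Q = Q]) (auto simp: Q_def R_def)
  then have "A = [:e:]" "A = [:f:]"
    by (auto simp: R_def)
  then have "e ^ 2 = 1"
    using ef by (simp add: power2_eq_square)
  then have "e = 1 \<or> e = -1"
    by (simp add: power2_eq_1_iff)
  with \<open>A = [:e:]\<close> show "A = 1 \<or> A = -1"
    by (auto simp: one_pCons)
qed

section \<open>Entire solutions of \<open>u^2 + w^2 = 1\<close> with \<open>w\<close> of finite
  order\<close>

lemma circle_equation_finite_order:
  assumes u: "u holomorphic_on UNIV" and w: "w holomorphic_on UNIV"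
    and eq: "\<And>z. (u z)\<^sup>2 + (w z)\<^sup>2 = 1" and fin: "growth_order w < \<infinity>"
  obtains p where "\<And>z. u z = cosh (poly p z)" "\<And>z. w z = - \<i> * sinh (poly p z)"
proof -
  define E where "E = (\<lambda>z. u z + \<i> * w z)"
  have E1: "E z * (u z - \<i> * w z) = 1" for z
    using eq[of z] by (simp add: E_def algebra_simps power2_eq_square)
  have "E holomorphic_on UNIV"
    unfolding E_def by (intro holomorphic_intros u w)
  moreover have "E z \<noteq> 0" for z
    using E1[of z] by auto
  ultimately obtain g where g: "g holomorphic_on UNIV" and gE: "\<And>z. exp (g z) = E z"
    using holomorphic_logarithm_exists[of UNIV E 0] by auto
  have gE': "exp (- g z) = u z - \<i> * w z" for z
    using E1[of z] by (simp add: exp_minus gE inverse_unique)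
  \<comment> \<open>Here \<open>E = 2 i w + 1 / E\<close>. Where \<open>|E| >= 1\<close> the last
    term has norm at most 1, so \<open>|E| <= 2 |w| + 1 <= 3 max 1 |w|\<close>; elsewhere
    \<open>max 1 |E| = 1\<close> and the bound is trivial.\<close>
  have le: "log_plus (norm (exp (g z))) \<le> ln 3 + log_plus (norm (w z))" for z
  proof -
    have "exp (g z) = 2 * \<i> * w z + exp (- g z)"
      by (simp add: gE gE' E_def)
    then have "norm (exp (g z)) \<le> 2 * norm (w z) + norm (exp (- g z))"
      using norm_triangle_ineq[of "2 * \<i> * w z" "exp (- g z)"] by (simp add: norm_mult)
    moreover have "norm (exp (- g z)) \<le> 1" if "norm (exp (g z)) \<ge> 1"
      using that by simp
    ultimately have "max 1 (norm (exp (g z))) \<le> 3 * max 1 (norm (w z))"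
      by linarith
    then have "ln (max 1 (norm (exp (g z)))) \<le> ln (3 * max 1 (norm (w z)))"
      by (subst ln_le_cancel_iff) auto
    also have "\<dots> = ln 3 + ln (max 1 (norm (w z)))"
      by (rule ln_mult_pos) auto
    finally show ?thesis
      by (simp add: log_plus_def)
  qed
  have prox: "proximity_fun r (\<lambda>z. exp (g z)) \<le> ln 3 + proximity_fun r w" for r
  proof -
    have "integral {0..2 * pi} (\<lambda>t. log_plus (norm (exp (g (of_real r * cis t)))))
        \<le> integral {0..2 * pi} (\<lambda>t. ln 3 + log_plus (norm (w (of_real r * cis t))))"
      using w g le
      by (intro integral_le integrable_add log_plus_circle_integrable)
        (auto intro!: log_plus_circle_integrable holomorphic_intros)
    also have "\<dots> = 2 * pi * ln 3 + integral {0..2 * pi} (\<lambda>t. log_plus (norm (w (of_real r * cis t))))"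
      using w by (subst integral_add) (auto intro: log_plus_circle_integrable)
    finally show ?thesis
      by (simp add: proximity_fun_def field_simps)
  qed
  obtain n where "\<forall>\<^sub>F r in at_top. proximity_fun r w \<le> r ^ n"
    using proximity_fun_finite_order[OF w fin] by blast
  then have "\<forall>\<^sub>F r in at_top. proximity_fun r (\<lambda>z. exp (g z)) \<le> ln 3 + r ^ n"
    by eventually_elim (use prox in \<open>smt (verit)\<close>)
  then obtain p where p: "g = poly p"
    using entire_eq_poly_if_proximity_exp_le[OF g] by blast
  show thesis
  proof
    fix z
    show "u z = cosh (poly p z)"
      unfolding p[symmetric] cosh_field_def gE gE' by (simp add: E_def)
    show "w z = - \<i> * sinh (poly p z)"
      unfolding p[symmetric] sinh_field_def gE gE' by (simp add: E_def)
  qed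
qed

section \<open>Finite-order solutions of the system are shifted sines\<close>

lemma smult_ii_unit:
  assumes "smult (- \<i>) d = 1 \<or> smult (- \<i>) d = -1"
  shows "d = [:\<i>:] \<or> d = [:- \<i>:]"
proof -
  have "d = smult \<i> (smult (- \<i>) d)" by simp
  moreover have "smult \<i> 1 = [:\<i>:]" "smult \<i> (-1) = [:- \<i>:]"
    by (simp_all add: one_pCons)
  ultimately show ?thesis
    using assms by metis
qed

text \<open>The hypothesis makes \<open>p\<close> linear with slope \<open>i\<close> or
  \<open>-i\<close>. Slope \<open>i\<close> gives a sine directly; slope \<open>-i\<close> gives a
  negated sine, whose sign is absorbed by a further shift by \<open>pi\<close>.\<close>

lemma sinh_poly_eq_sin:
  assumes "smult (- \<i>) (pderiv p) = 1 \<or> smult (- \<i>) (pderiv p) = -1"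
  shows "\<exists>B. \<forall>z. - \<i> * sinh (poly p z) = sin (z + B)"
proof -
  obtain s where s: "s = \<i> \<or> s = - \<i>" and ps: "pderiv p = [:s:]"
    using smult_ii_unit[OF assms] by blast
  have "pderiv (p - [:0, s:]) = 0"
    by (simp add: pderiv_diff pderiv_pCons ps)
  then obtain b where "p - [:0, s:] = [:b:]"
    using degree_eq_zeroE pderiv_eq_0_iff by blast
  then have p: "p = [:b, s:]"
    by (simp add: diff_eq_eq)
  from s show ?thesis
  proof
    assume "s = \<i>"
    then have "- \<i> * sinh (poly p z) = sin (z + (- \<i> * b))" for z
      by (simp add: p sin_conv_sinh algebra_simps)
    then show ?thesis by blast
  next
    assume "s = - \<i>"
    have "- \<i> * sinh (poly p z) = - sin (z + \<i> * b)" for z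
      using sinh_minus[of "poly p z"] by (simp add: p sin_conv_sinh \<open>s = - \<i>\<close> algebra_simps)
    also have "- sin (z + \<i> * b) = sin (z + (\<i> * b + of_real pi))" for z
      unfolding add.assoc[symmetric] by (subst (2) sin_add) simp
    finally show ?thesis by blast
  qed
qed

lemma finite_order_solution_form:
  assumes q: "q \<noteq> 0" and sol: "transcendental_entire_solution q c w1 w2"
    and fin: "pair_order w1 w2 < \<infinity>"
  shows "(q = 1 \<or> q = -1) \<and> (\<exists>B1 B2. w1 = (\<lambda>z. sin (z + B1)) \<and> w2 = (\<lambda>z. sin (z + B2)))"
proof -
  \<comment> \<open>Treats one equation with \<open>f\<close> and \<open>g\<close> free, so that it
    serves both equations of the system with \<open>w1\<close> and \<open>w2\<close>
    exchanged.\<close>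
  have key: "\<exists>P. (\<forall>z. deriv f z = cosh (poly (pcompose P [:c, q:]) z)) \<and>
      (\<forall>z. g z = - \<i> * sinh (poly P z)) \<and> degree P > 0"
    if f: "f holomorphic_on UNIV" and g: "transcendental_entire g"
      and eq: "\<And>z. (deriv f z)\<^sup>2 + (g (q * z + c))\<^sup>2 = 1" and g_fin: "growth_order g < \<infinity>" for f g
  proof -
    \<comment> \<open>Substituting \<open>(z - c) / q\<close> for \<open>z\<close> removes the shift
      and scaling from \<open>g\<close>, leaving a pointwise circle equation.\<close>
    have "(\<lambda>z. deriv f ((z - c) / q)) holomorphic_on UNIV"
      using q by (intro holomorphic_on_compose_gen[of "\<lambda>z. (z - c) / q" UNIV "deriv f" UNIV,
          unfolded o_def] holomorphic_intros holomorphic_deriv f) auto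
    moreover have "g holomorphic_on UNIV"
      using g by (simp add: transcendental_entire_def)
    moreover have "(deriv f ((z - c) / q))\<^sup>2 + (g z)\<^sup>2 = 1" for z
      using eq[of "(z - c) / q"] q by simp
    ultimately obtain P where P: "\<And>z. deriv f ((z - c) / q) = cosh (poly P z)"
        "\<And>z. g z = - \<i> * sinh (poly P z)"
      using g_fin by (rule circle_equation_finite_order) blast
    have "deriv f z = cosh (poly (pcompose P [:c, q:]) z)" for z
      using P(1)[of "c + q * z"] q by (simp add: poly_pcompose mult.commute)
    \<comment> \<open>A constant \<open>P\<close> would make \<open>g\<close> a polynomial. Positive
      degree is what \<open>cosh_poly_eq_cases\<close> asks for.\<close>
    moreover have "degree P > 0"
    proof (rule ccontr)
      assume "\<not> degree P > 0"
      then obtain k where "P = [:k:]"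
        using degree_eq_zeroE by blast
      then have "g = poly [:- \<i> * sinh k:]"
        using P(2) by (simp add: fun_eq_iff)
      then show False
        using g unfolding transcendental_entire_def by blast
    qed
    ultimately show ?thesis
      using P(2) by blast
  qed
  have w: "transcendental_entire w1" "transcendental_entire w2"
    and hol: "w1 holomorphic_on UNIV" "w2 holomorphic_on UNIV"
    and eq: "\<And>z. (deriv w1 z)\<^sup>2 + (w2 (q * z + c))\<^sup>2 = 1"
      "\<And>z. (deriv w2 z)\<^sup>2 + (w1 (q * z + c))\<^sup>2 = 1"
    using sol by (auto simp: transcendental_entire_solution_def transcendental_entire_def
        solves_system_def)
  have ord: "growth_order w1 < \<infinity>" "growth_order w2 < \<infinity>"
    using fin by (simp_all only: pair_order_def max_less_iff_conj)
  obtain P where P: "\<And>z. deriv w1 z = cosh (poly (pcompose P [:c, q:]) z)"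
      "\<And>z. w2 z = - \<i> * sinh (poly P z)" "degree P > 0"
    using key[OF hol(1) w(2) eq(1) ord(2)] by blast
  obtain R where R: "\<And>z. deriv w2 z = cosh (poly (pcompose R [:c, q:]) z)"
      "\<And>z. w1 z = - \<i> * sinh (poly R z)" "degree R > 0"
    using key[OF hol(2) w(1) eq(2) ord(1)] by blast
  \<comment> \<open>Differentiating the \<open>sinh\<close> forms gives second expressions for
    \<open>deriv w1\<close> and \<open>deriv w2\<close>, to be equated with the \<open>cosh\<close>
    forms.\<close>
  have der: "deriv (\<lambda>z. - \<i> * sinh (poly p z)) z
      = poly (smult (- \<i>) (pderiv p)) z * cosh (poly p z)" for p z
    by (rule DERIV_imp_deriv) (auto intro!: derivative_eq_intros)
  have fw: "w1 = (\<lambda>z. - \<i> * sinh (poly R z))" "w2 = (\<lambda>z. - \<i> * sinh (poly P z))"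
    using P(2) R(2) by (simp_all add: fun_eq_iff)
  have deg: "degree (pcompose P [:c, q:]) > 0" "degree (pcompose R [:c, q:]) > 0"
    using P(3) R(3) q by (simp_all add: degree_pcompose)
  note cosh1 = cosh_poly_eq_cases[OF deg(1) R(3), of "smult (- \<i>) (pderiv R)"]
  note cosh2 = cosh_poly_eq_cases[OF deg(2) P(3), of "smult (- \<i>) (pderiv P)"]
  have e1: "cosh (poly (pcompose P [:c, q:]) z)
      = poly (smult (- \<i>) (pderiv R)) z * cosh (poly R z)" for z
    using P(1)[of z] unfolding fw(1) der ..
  have e2: "cosh (poly (pcompose R [:c, q:]) z)
      = poly (smult (- \<i>) (pderiv P)) z * cosh (poly P z)" for z
    using R(1)[of z] unfolding fw(2) der ..
  have R': "smult (- \<i>) (pderiv R) = 1 \<or> smult (- \<i>) (pderiv R) = -1"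
    and P': "smult (- \<i>) (pderiv P) = 1 \<or> smult (- \<i>) (pderiv P) = -1"
    using cosh1(1) cosh2(1) e1 e2 by blast+
  obtain B1 where "\<And>z. - \<i> * sinh (poly R z) = sin (z + B1)"
    using sinh_poly_eq_sin[OF R'] by blast
  moreover obtain B2 where "\<And>z. - \<i> * sinh (poly P z) = sin (z + B2)"
    using sinh_poly_eq_sin[OF P'] by blast
  ultimately have "\<exists>B1 B2. w1 = (\<lambda>z. sin (z + B1)) \<and> w2 = (\<lambda>z. sin (z + B2))"
    unfolding fw by (metis (lifting))
  moreover have "q = 1 \<or> q = -1"
  proof -
    \<comment> \<open>By the chain rule \<open>q P'(c + q z)\<close> equals \<open>R'(z)\<close> or
      its negative. Both \<open>P'\<close> and \<open>R'\<close> are the constant \<open>i\<close>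
      or \<open>-i\<close>, so \<open>q\<close> is 1 or -1.\<close>
    have "pcompose (pderiv P) [:c, q:] * [:q:] = pderiv R \<or>
        pcompose (pderiv P) [:c, q:] * [:q:] = - pderiv R"
      using cosh1(2)[OF e1] by (simp add: pderiv_pcompose pderiv_pCons)
    then have "\<i> * q = \<i> \<or> \<i> * q = - \<i>"
      using smult_ii_unit[OF P'] smult_ii_unit[OF R']
      by (auto simp: pcompose_pCons complex_eq_iff)
    then have "\<i> * q = \<i> * 1 \<or> \<i> * q = \<i> * (-1)"
      by simp
    then show ?thesis
      unfolding mult_cancel_left by simp
  qed
  ultimately show ?thesis by blast
qed

section \<open>Shifted sines are transcendental and of finite order\<close>

lemma norm_sin_le_exp: "norm (sin z) \<le> exp (norm (z :: complex))"
proof -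
  have "norm (exp (\<i> * z)) \<le> exp (norm z)" "norm (exp (- (\<i> * z))) \<le> exp (norm z)"
    using norm_exp[of "\<i> * z"] norm_exp[of "- (\<i> * z)"] by (simp_all add: norm_mult del: norm_exp_eq_Re)
  moreover have "norm (sin z) = norm (exp (\<i> * z) - exp (- (\<i> * z))) / 2"
    by (simp add: sin_exp_eq norm_divide norm_mult)
  ultimately show ?thesis
    using norm_triangle_ineq4[of "exp (\<i> * z)" "exp (- (\<i> * z))"] by linarith
qed

text \<open>A nonzero polynomial has finitely many roots, whereas every \<open>n pi - B\<close> is a
  zero here.\<close>

lemma transcendental_entire_sin_shift: "transcendental_entire (\<lambda>z. sin (z + B))"
  unfolding transcendental_entire_def
proof safe
  show "(\<lambda>z. sin (z + B)) holomorphic_on UNIV"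
    by (intro holomorphic_intros)
next
  fix p assume p: "(\<lambda>z. sin (z + B)) = poly p"
  have "p \<noteq> 0"
    \<comment> \<open>At this point the sine equals 1, which excludes the zero polynomial.\<close>
    using fun_cong[OF p, of "of_real (pi / 2) - B"] by (auto simp: sin_of_real)
  then have "finite {z. poly p z = 0}"
    by (rule poly_roots_finite)
  moreover have "(\<lambda>n :: nat. of_real (real n * pi) - B) ` UNIV \<subseteq> {z. poly p z = 0}"
    unfolding p[symmetric] by (auto simp: sin_of_real simp del: of_real_mult)
  moreover have "inj (\<lambda>n :: nat. of_real (real n * pi) - B :: complex)"
    by (auto simp: inj_def simp del: of_real_mult)
  ultimately show False
    using finite_imageD finite_subset infinite_UNIV_nat by blast
qed

lemma growth_order_sin_shift: "growth_order (\<lambda>z. sin (z + B)) < \<infinity>"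
proof -
  let ?f = "\<lambda>z. sin (z + B)"
  have hol: "?f holomorphic_on UNIV"
    by (intro holomorphic_intros)
  have prox: "proximity_fun r ?f \<le> r + norm B" if "r \<ge> 0" for r
  proof -
    have "log_plus (norm (?f (of_real r * cis t))) \<le> r + norm B" for t
    proof -
      have "norm (?f (of_real r * cis t)) \<le> exp (norm (of_real r * cis t + B))"
        by (rule norm_sin_le_exp)
      also have "\<dots> \<le> exp (r + norm B)"
        using norm_triangle_ineq[of "of_real r * cis t" B] that by (simp add: norm_mult)
      finally have "max 1 (norm (?f (of_real r * cis t))) \<le> exp (r + norm B)"
        using that by simp
      then have "ln (max 1 (norm (?f (of_real r * cis t)))) \<le> ln (exp (r + norm B))"
        by (subst ln_le_cancel_iff) auto
      then show ?thesis
        by (simp add: log_plus_def)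
    qed
    then have "integral {0..2 * pi} (\<lambda>t. log_plus (norm (?f (of_real r * cis t))))
        \<le> integral {0..2 * pi} (\<lambda>t. r + norm B)"
      by (intro integral_le log_plus_circle_integrable hol) auto
    then show ?thesis
      by (simp add: proximity_fun_def field_simps)
  qed
  have "growth_order ?f \<le> ereal 2"
    unfolding growth_order_def
  proof (rule Limsup_bounded)
    show "\<forall>\<^sub>F r in at_top. ereal (log_plus (nevanlinna_T r ?f) / ln r) \<le> ereal 2"
      \<comment> \<open>The threshold gives \<open>r + |B| <= 2 r <= r^2\<close>, hence the bound 2;
        it is not sharp, but only finiteness is claimed.\<close>
      using eventually_ge_at_top[of "max 2 (norm B)"]
    proof eventually_elim
      case (elim r)
      have "nevanlinna_T r ?f \<le> r + norm B"
        using prox[of r] elim by (simp add: nevanlinna_T_entire[OF hol])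
      also have "\<dots> \<le> 2 * r"
        using elim by simp
      also have "\<dots> \<le> r * r"
        using elim by (intro mult_right_mono) auto
      finally have "max 1 (nevanlinna_T r ?f) \<le> r ^ 2"
        using elim one_le_power[of r 2] by (simp add: power2_eq_square)
      then have "ln (max 1 (nevanlinna_T r ?f)) \<le> ln (r ^ 2)"
        using elim by (subst ln_le_cancel_iff) auto
      then have "log_plus (nevanlinna_T r ?f) \<le> 2 * ln r"
        using elim by (simp add: log_plus_def ln_realpow)
      then show ?case
        using elim by (simp add: divide_le_eq)
    qed
  qed
  then show ?thesis
    by (rule le_less_trans) simp
qed

section \<open>Which pairs of shifted sines solve the system\<close>

text \<open>At \<open>z = -a\<close> the cosine is 1, which forces \<open>sin (b - a) = 0\<close>.
  Conversely \<open>cos (b - a)\<close> then has square 1, so \<open>sin (z + b)\<close> is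
  \<open>sin (z + a)\<close> up to sign.\<close>

lemma cos_sin_shift_iff:
  "(\<forall>z. (cos (z + a))\<^sup>2 + (sin (z + b))\<^sup>2 = 1) \<longleftrightarrow> sin (b - a) = (0 :: complex)"
proof
  assume "\<forall>z. (cos (z + a))\<^sup>2 + (sin (z + b))\<^sup>2 = 1"
  from spec[OF this, of "- a"] show "sin (b - a) = 0"
    by simp
next
  assume d: "sin (b - a) = 0"
  then have c: "(cos (b - a))\<^sup>2 = 1"
    using sin_cos_squared_add[of "b - a"] by simp
  show "\<forall>z. (cos (z + a))\<^sup>2 + (sin (z + b))\<^sup>2 = 1"
  proof
    fix z
    have "sin (z + b) = sin ((z + a) + (b - a))"
      by simp
    also have "\<dots> = sin (z + a) * cos (b - a)"
      unfolding sin_add[of "z + a"] d by simp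
    finally show "(cos (z + a))\<^sup>2 + (sin (z + b))\<^sup>2 = 1"
      by (simp add: power_mult_distrib c)
  qed
qed

lemma deriv_sin_shift: "deriv (\<lambda>z. sin (z + B)) z = cos (z + B)" for B :: complex
  by (rule DERIV_imp_deriv) (auto intro!: derivative_eq_intros)

lemma solves_system_sin_1:
  "solves_system 1 c (\<lambda>z. sin (z + B1)) (\<lambda>z. sin (z + B2)) \<longleftrightarrow>
     sin (c + B2 - B1) = 0 \<and> sin (c + B1 - B2) = 0"
  using cos_sin_shift_iff[of B1 "c + B2"] cos_sin_shift_iff[of B2 "c + B1"]
  by (auto simp: solves_system_def deriv_sin_shift add.assoc)

text \<open>Reflecting the argument changes the sine only by a sign, invisible after squaring. Both
  equations then reduce to the same condition, as \<open>B1\<close> and \<open>B2\<close> enter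
  symmetrically.\<close>

lemma solves_system_sin_minus_1:
  "solves_system (-1) c (\<lambda>z. sin (z + B1)) (\<lambda>z. sin (z + B2)) \<longleftrightarrow> sin (B1 + B2 + c) = 0"
proof -
  have sq: "(sin (c - z + B))\<^sup>2 = (sin (z + (- c - B)))\<^sup>2" for z B
    using sin_minus[of "z + (- c - B)"] by (simp add: algebra_simps)
  have "- c - B2 - B1 = - (B1 + B2 + c)" "- c - B1 - B2 = - (B1 + B2 + c)"
    by simp_all
  then have "sin (- c - B2 - B1) = - sin (B1 + B2 + c)" "sin (- c - B1 - B2) = - sin (B1 + B2 + c)"
    by (simp_all only: sin_minus)
  then show ?thesis
    using cos_sin_shift_iff[of B1 "- c - B2"] cos_sin_shift_iff[of B2 "- c - B1"]
    by (auto simp: solves_system_def deriv_sin_shift sq)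
qed

text \<open>If \<open>c + d = m pi\<close> and \<open>c - d = n pi\<close>, then
  \<open>c = (m + n) pi / 2\<close>, and the parity of \<open>m + n\<close> selects the alternative.
  It is applied with \<open>d = B1 - B2\<close>.\<close>

lemma sin_eq_0_pair_iff:
  "sin (c + d) = 0 \<and> sin (c - d) = 0 \<longleftrightarrow>
     (\<exists>k l :: int. (c = of_int k * of_real pi \<and> d = of_int l * of_real pi) \<or>
        (c = of_real pi / 2 + of_int k * of_real pi \<and> d = of_real pi / 2 + of_int l * of_real pi))"
  for c d :: complex
proof -
  have s0: "sin z = 0 \<longleftrightarrow> (\<exists>n :: int. z = of_int n * of_real pi)" for z :: complex
    by (simp add: sin_eq_0)
  show ?thesis
  proof (intro iffI)
    assume "sin (c + d) = 0 \<and> sin (c - d) = 0"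
    then obtain m n :: int where mn: "c + d = of_int m * of_real pi" "c - d = of_int n * of_real pi"
      using s0 by blast
    have cd: "c = ((c + d) + (c - d)) / 2" "d = (c + d) - c"
      by simp_all
    show "\<exists>k l :: int. (c = of_int k * of_real pi \<and> d = of_int l * of_real pi) \<or>
        (c = of_real pi / 2 + of_int k * of_real pi \<and> d = of_real pi / 2 + of_int l * of_real pi)"
    proof (cases "even (m + n)")
      case True
      then obtain k where "m + n = 2 * k" ..
      then have n: "n = 2 * k - m" by simp
      have "c = of_int k * of_real pi"
        by (subst cd(1)) (simp add: mn n algebra_simps)
      moreover from this have "d = of_int (m - k) * of_real pi"
        using mn(1) by (simp add: algebra_simps)
      ultimately show ?thesis by blast
    next
      case False
      then obtain k where "m + n = 2 * k + 1" ..
      then have n: "n = 2 * k + 1 - m" by simp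
      have "c = of_real pi / 2 + of_int k * of_real pi"
        by (subst cd(1)) (simp add: mn n field_simps)
      \<comment> \<open>The index drops by one because \<open>d = m pi - c\<close> contains
        \<open>- pi / 2\<close>, rewritten as \<open>pi / 2 - pi\<close>.\<close>
      moreover have "d = of_real pi / 2 + of_int (m - k - 1) * of_real pi"
        by (subst cd(2), subst mn(1), subst calculation) (simp add: field_simps)
      ultimately show ?thesis by blast
    qed
  next
    assume "\<exists>k l :: int. (c = of_int k * of_real pi \<and> d = of_int l * of_real pi) \<or>
        (c = of_real pi / 2 + of_int k * of_real pi \<and> d = of_real pi / 2 + of_int l * of_real pi)"
    then obtain k l :: int where "(c = of_int k * of_real pi \<and> d = of_int l * of_real pi) \<or>
        (c = of_real pi / 2 + of_int k * of_real pi \<and> d = of_real pi / 2 + of_int l * of_real pi)"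
      by blast
    \<comment> \<open>In the half-integer case the two halves cancel in \<open>c - d\<close> and add
      up to one more \<open>pi\<close> in \<open>c + d\<close>.\<close>
    then have "c - d = of_int (k - l) * of_real pi"
      "c + d = of_int (k + l) * of_real pi \<or> c + d = of_int (k + l + 1) * of_real pi"
      by (auto simp: algebra_simps)
    then show "sin (c + d) = 0 \<and> sin (c - d) = 0"
      unfolding s0 by blast
  qed
qed

section \<open>Classification for \<open>q = 1\<close> and \<open>q = -1\<close>, and the
  theorem\<close>

lemma sin_shift_solution:
  assumes "solves_system q c (\<lambda>z. sin (z + B1)) (\<lambda>z. sin (z + B2))"
  shows "transcendental_entire_solution q c (\<lambda>z. sin (z + B1)) (\<lambda>z. sin (z + B2))"
    and "pair_order (\<lambda>z. sin (z + B1)) (\<lambda>z. sin (z + B2)) < \<infinity>"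
  using assms
  by (simp add: transcendental_entire_solution_def transcendental_entire_sin_shift)
    (simp only: pair_order_def max_less_iff_conj growth_order_sin_shift)

text \<open>Every finite-order solution is a pair of shifted sines, and every such pair is
  transcendental of finite order, so only the system itself remains to be tested on these
  pairs.\<close>

lemma solution_iff_sin:
  assumes "q = 1 \<or> q = -1"
  shows "transcendental_entire_solution q c w1 w2 \<and> pair_order w1 w2 < \<infinity> \<longleftrightarrow>
    (\<exists>B1 B2. w1 = (\<lambda>z. sin (z + B1)) \<and> w2 = (\<lambda>z. sin (z + B2)) \<and>
       solves_system q c (\<lambda>z. sin (z + B1)) (\<lambda>z. sin (z + B2)))"
  (is "?sol \<longleftrightarrow> ?sin")
proof
  assume sol: ?sol
  have "q \<noteq> 0"
    using assms by auto
  with sol obtain B1 B2 where "w1 = (\<lambda>z. sin (z + B1))" "w2 = (\<lambda>z. sin (z + B2))"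
    using finite_order_solution_form by blast
  moreover have "solves_system q c w1 w2"
    using sol by (simp add: transcendental_entire_solution_def)
  ultimately show ?sin by blast
next
  assume ?sin
  then show ?sol
    using sin_shift_solution by blast
qed

theorem theorem3p2:
  fixes q c :: complex
  assumes "q \<noteq> 0"
  shows "(q \<noteq> 1 \<and> q \<noteq> -1 \<longrightarrow>
            \<not> (\<exists>w1 w2. transcendental_entire_solution q c w1 w2 \<and> pair_order w1 w2 < \<infinity>)) \<and>
         (q = 1 \<longrightarrow>
            (\<forall>w1 w2. transcendental_entire_solution q c w1 w2 \<and> pair_order w1 w2 < \<infinity> \<longleftrightarrow>
               (\<exists>B1 B2. w1 = (\<lambda>z. sin (z + B1)) \<and> w2 = (\<lambda>z. sin (z + B2)) \<and>
                  (\<exists>k l :: int.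
                     (c = of_int k * of_real pi \<and> B1 - B2 = of_int l * of_real pi) \<or>
                     (c = of_real pi / 2 + of_int k * of_real pi \<and>
                      B1 - B2 = of_real pi / 2 + of_int l * of_real pi))))) \<and>
         (q = -1 \<longrightarrow>
            (\<forall>w1 w2. transcendental_entire_solution q c w1 w2 \<and> pair_order w1 w2 < \<infinity> \<longleftrightarrow>
               (\<exists>B1 B2. w1 = (\<lambda>z. sin (z + B1)) \<and> w2 = (\<lambda>z. sin (z + B2)) \<and>
                  (\<exists>k :: int. B1 + B2 + c = of_int k * of_real pi))))"
proof (intro conjI impI allI)
  assume "q \<noteq> 1 \<and> q \<noteq> -1"
  then show "\<not> (\<exists>w1 w2. transcendental_entire_solution q c w1 w2 \<and> pair_order w1 w2 < \<infinity>)"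
    using finite_order_solution_form[OF assms] by blast
next
  fix w1 w2
  assume q: "q = 1"
  have "solves_system q c (\<lambda>z. sin (z + B1)) (\<lambda>z. sin (z + B2)) \<longleftrightarrow>
      (\<exists>k l :: int. (c = of_int k * of_real pi \<and> B1 - B2 = of_int l * of_real pi) \<or>
         (c = of_real pi / 2 + of_int k * of_real pi \<and>
          B1 - B2 = of_real pi / 2 + of_int l * of_real pi))" for B1 B2
    unfolding sin_eq_0_pair_iff[symmetric] q solves_system_sin_1
    by (auto simp: algebra_simps)
  then show "transcendental_entire_solution q c w1 w2 \<and> pair_order w1 w2 < \<infinity> \<longleftrightarrow>
               (\<exists>B1 B2. w1 = (\<lambda>z. sin (z + B1)) \<and> w2 = (\<lambda>z. sin (z + B2)) \<and>
                  (\<exists>k l :: int.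
                     (c = of_int k * of_real pi \<and> B1 - B2 = of_int l * of_real pi) \<or>
                     (c = of_real pi / 2 + of_int k * of_real pi \<and>
                      B1 - B2 = of_real pi / 2 + of_int l * of_real pi)))"
    using solution_iff_sin[of q c w1 w2] q by simp
next
  fix w1 w2
  assume q: "q = -1"
  have "solves_system q c (\<lambda>z. sin (z + B1)) (\<lambda>z. sin (z + B2)) \<longleftrightarrow>
      (\<exists>k :: int. B1 + B2 + c = of_int k * of_real pi)" for B1 B2
    unfolding q solves_system_sin_minus_1 by (simp add: sin_eq_0)
  then show "transcendental_entire_solution q c w1 w2 \<and> pair_order w1 w2 < \<infinity> \<longleftrightarrow>
               (\<exists>B1 B2. w1 = (\<lambda>z. sin (z + B1)) \<and> w2 = (\<lambda>z. sin (z + B2)) \<and>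
                  (\<exists>k :: int. B1 + B2 + c = of_int k * of_real pi))"
    using solution_iff_sin[of q c w1 w2] q by simp
qed

end
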